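(* Let $n\ge1$ and $h\ge n(n-1)$ be integers. There exists an online algorithm that is simultaneously $1/e$-competitive for the $h$-AO-SP and $(1-1/e)$-competitive for the $h$-RO-SP (both with $n$ online candidates).
   Context: Both problems, for integers $n\ge1$, $h\ge0$: an adversary picks a set $C$ of $n+h$ candidates with values in $\mathbb{R}_{\ge0}$ (totally ordered by value, ties broken by a fixed consistent tie-breaker). A subset $H\subseteq C$ of cardinality $h$ (history set) is drawn uniformly at random and given to the online player upfront together with $n$; $O=C\setminus H$. The candidates of $O$ are presented one by one; after each arrival the player must irrevocably accept or reject it, and accepting terminates. In the $h$-AO-SP the presentation order of $O$ is chosen by the adversary (possibly depending on $H$); in the $h$-RO-SP it is uniformly random. $\mathrm{ALG}$ is the value of the accepted candidate (0 if none), $\mathrm{OPT}=\max O$. An algorithm is $c$-competitive if $\mathbb{E}[\mathrm{ALG}]\ge c\,\mathbb{E}[\mathrm{OPT}]$ for every $C$ (and, in the AO case, every adversarial ordering strategy), expectation over $H$, the random order (RO case), and the algorithm's randomness. *)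

theory Defs
  imports "HOL-Probability.Probability" "HOL-Combinatorics.Multiset_Permutations"
begin

text \<open>
  The tag lets different candidates share a value and acts as the fixed tie-breaker: candidates are
  ordered lexicographically, by value and then by tag. Tags are chosen by the adversary together
  with the values, and the player may observe them, hence compare tied candidates.
\<close>

datatype candidate = Candidate (cvalue: real) (ctag: nat)

instantiation candidate :: linorder
begin

definition less_eq_candidate :: "candidate \<Rightarrow> candidate \<Rightarrow> bool" where
  "x \<le> y \<longleftrightarrow> cvalue x < cvalue y \<or> cvalue x = cvalue y \<and> ctag x \<le> ctag y"

definition less_candidate :: "candidate \<Rightarrow> candidate \<Rightarrow> bool" where
  "x < y \<longleftrightarrow> cvalue x < cvalue y \<or> cvalue x = cvalue y \<and> ctag x < ctag y"

instance
  by standard (auto simp: less_eq_candidate_def less_candidate_def intro: candidate.expand)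

end

definition instances :: "nat \<Rightarrow> nat \<Rightarrow> candidate set set" where
  "instances n h = {C. finite C \<and> card C = n + h \<and> (\<forall>x\<in>C. 0 \<le> cvalue x)}"

definition history_sets :: "nat \<Rightarrow> candidate set \<Rightarrow> candidate set set" where
  "history_sets h C = {H. H \<subseteq> C \<and> card H = h}"

text \<open>
  A deterministic policy is given the list of all arrivals so far, in order of arrival and ending
  with the current one, and answers whether the current candidate is accepted.
\<close>

type_synonym policy = "candidate list \<Rightarrow> bool"

text \<open>
  A randomized online algorithm reads the history set and then draws a deterministic policy. The
  numbers \<open>n\<close> and \<open>h\<close> are fixed wherever an algorithm is considered, so it may depend on them.
\<close>

type_synonym algorithm = "candidate set \<Rightarrow> policy pmf"

fun run_policy :: "policy \<Rightarrow> candidate list \<Rightarrow> candidate list \<Rightarrow> candidate option" where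
  "run_policy d seen [] = None"
| "run_policy d seen (x # xs) =
     (if d (seen @ [x]) then Some x else run_policy d (seen @ [x]) xs)"

definition payoff :: "policy \<Rightarrow> candidate list \<Rightarrow> real" where
  "payoff d xs = (case run_policy d [] xs of None \<Rightarrow> 0 | Some x \<Rightarrow> cvalue x)"

text \<open>
  The presentation order is drawn from \<open>ord H\<close>. Given \<open>H\<close>, it is independent of the algorithm's
  internal randomness.
\<close>

definition ALG_pmf ::
    "nat \<Rightarrow> candidate set \<Rightarrow> (candidate set \<Rightarrow> candidate list pmf) \<Rightarrow> algorithm \<Rightarrow> real pmf" where
  "ALG_pmf h C ord A =
     do { H \<leftarrow> pmf_of_set (history_sets h C);
          xs \<leftarrow> ord H;
          d \<leftarrow> A H;
          return_pmf (payoff d xs) }"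

definition expected_ALG ::
    "nat \<Rightarrow> candidate set \<Rightarrow> (candidate set \<Rightarrow> candidate list pmf) \<Rightarrow> algorithm \<Rightarrow> real" where
  "expected_ALG h C ord A = measure_pmf.expectation (ALG_pmf h C ord A) (\<lambda>v. v)"

definition expected_OPT :: "nat \<Rightarrow> candidate set \<Rightarrow> real" where
  "expected_OPT h C =
     measure_pmf.expectation (pmf_of_set (history_sets h C)) (\<lambda>H. cvalue (Max (C - H)))"

definition adversarial_orders :: "nat \<Rightarrow> candidate set \<Rightarrow> (candidate set \<Rightarrow> candidate list) set" where
  "adversarial_orders h C =
     {\<sigma>. \<forall>H \<in> history_sets h C. \<sigma> H \<in> permutations_of_set (C - H)}"

definition AO_competitive :: "nat \<Rightarrow> nat \<Rightarrow> real \<Rightarrow> algorithm \<Rightarrow> bool" where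
  "AO_competitive n h c A \<longleftrightarrow>
     (\<forall>C \<in> instances n h. \<forall>\<sigma> \<in> adversarial_orders h C.
        expected_ALG h C (\<lambda>H. return_pmf (\<sigma> H)) A \<ge> c * expected_OPT h C)"

definition RO_competitive :: "nat \<Rightarrow> nat \<Rightarrow> real \<Rightarrow> algorithm \<Rightarrow> bool" where
  "RO_competitive n h c A \<longleftrightarrow>
     (\<forall>C \<in> instances n h.
        expected_ALG h C (\<lambda>H. pmf_of_set (permutations_of_set (C - H))) A \<ge> c * expected_OPT h C)"

end

theory Submission imports Defs
begin

text \<open>
  Partition \<open>n\<^sup>2\<close> of the candidates at random into \<open>n\<close> groups of size \<open>n\<close>, each consisting of one online
  candidate and \<open>n - 1\<close> history candidates, and accept the first online candidate that is the best of
  its group. Given the groups, the online member of each group is uniform and these choices are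
  independent, so every group produces a record with probability \<open>1 / n\<close> independently of the others,
  and the best element of a group has expected value \<open>OPT\<close>. In random order the algorithm earns
  \<open>\<Sum>i<n. (1 / n) (1 - 1 / n)\<^sup>i = 1 - (1 - 1 / n)\<^sup>n \<ge> 1 - 1 / e\<close> times \<open>OPT\<close>. In adversarial order it still
  accepts the record whenever there is exactly one; the groups are drawn independently of the order
  of the arrivals, so this earns at least \<open>n (1 / n) (1 - 1 / n)\<^sup>n\<^sup>-\<^sup>1 \<ge> 1 / e\<close> times \<open>OPT\<close>.
\<close>

text \<open>
  The first \<open>n\<^sup>2\<close> positions of an ordering \<open>xs @ L\<close> of all candidates, \<open>xs\<close> being the arrivals and \<open>L\<close> the
  shuffled history, form a square grid with the arrivals in its first row; the groups are its columns.
\<close>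

definition grid_column :: "nat \<Rightarrow> nat \<Rightarrow> nat set" where
  "grid_column n i = (\<lambda>j. i + n * j) ` {..<n}"

text \<open>For \<open>i < n\<close>, position \<open>i\<close> is the first-row entry of column
  \<open>i\<close>: the group's online member is its best.\<close>

definition wins :: "nat \<Rightarrow> candidate list \<Rightarrow> nat \<Rightarrow> bool" where
  "wins n ys i \<longleftrightarrow> (\<forall>p\<in>grid_column n i. ys ! p \<le> ys ! i)"

text \<open>The current arrival has index \<open>length seen - 1\<close>. The arrivals fill row
  \<open>0\<close> of the grid, so row \<open>j + 1\<close> starts at offset \<open>n * j\<close> of
  \<open>L\<close>.\<close>

definition record_policy :: "nat \<Rightarrow> candidate list \<Rightarrow> policy" where
  "record_policy n L seen \<longleftrightarrow> (\<forall>j<n - 1. L ! (length seen - 1 + n * j) \<le> last seen)"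

definition record_algorithm :: "nat \<Rightarrow> algorithm" where
  "record_algorithm n H =
     bind_pmf (pmf_of_set (permutations_of_set H)) (\<lambda>L. return_pmf (record_policy n L))"

text \<open>The 0/1 factors encode "column \<open>i\<close> wins and no column of \<open>T\<close>
  does", so that columns can be split off one at a time. \<open>T = {..<i}\<close> describes
  stopping at the first win, \<open>T = {..<n} - {i}\<close> a unique win.\<close>

definition win_value :: "nat \<Rightarrow> candidate list \<Rightarrow> nat \<Rightarrow> nat set \<Rightarrow> real" where
  "win_value n ys i T =
     cvalue (ys ! i) * of_bool (wins n ys i) * (\<Prod>j\<in>T. 1 - of_bool (wins n ys j))"

subsection \<open>Columns of the grid\<close>

lemma finite_grid_column [simp]: "finite (grid_column n i)"
  by (simp add: grid_column_def)

lemma card_grid_column: "0 < n \<Longrightarrow> card (grid_column n i) = n"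
  unfolding grid_column_def by (subst card_image) (auto simp: inj_on_def)

lemma grid_column_self: "0 < n \<Longrightarrow> i \<in> grid_column n i"
  unfolding grid_column_def by (rule image_eqI[of _ _ 0]) auto

lemma grid_column_less:
  assumes "i < n" "p \<in> grid_column n i"
  shows "p < n * n"
proof -
  obtain j where j: "j < n" "p = i + n * j"
    using assms by (auto simp: grid_column_def)
  have "p < n * Suc j"
    using assms(1) j(2) by simp
  also have "\<dots> \<le> n * n"
    using j(1) by (intro mult_le_mono2) simp
  finally show ?thesis .
qed

lemma grid_column_mod: "i < n \<Longrightarrow> p \<in> grid_column n i \<Longrightarrow> p mod n = i"
  by (auto simp: grid_column_def)

lemma wins_append_iff:
  assumes "length xs = n" "i < n"
  shows "wins n (xs @ L) i \<longleftrightarrow> (\<forall>j<n - 1. L ! (i + n * j) \<le> xs ! i)"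
proof -
  obtain m where n: "n = Suc m"
    using assms(2) by (cases n) auto
  \<comment> \<open>Row \<open>0\<close> only compares the arrival with itself; the other rows lie
    in \<open>L\<close>, shifted by \<open>n\<close>.\<close>
  have "{..<n} = insert 0 (Suc ` {..<m})"
    by (auto simp: n lessThan_Suc_eq_insert_0)
  then have "grid_column n i = insert i ((\<lambda>j. n + (i + n * j)) ` {..<n - 1})"
    unfolding grid_column_def by (simp add: image_image n algebra_simps)
  then show ?thesis
    using assms by (auto simp: wins_def nth_append)
qed

subsection \<open>Symmetrization over positions\<close>

text \<open>Exchangeability of a uniform ordering: permuting positions is a bijection on orderings,
  undone by \<open>inv \<pi>\<close>.\<close>

lemma sum_permute_list:
  assumes "finite C" "\<pi> permutes {..<card C}"
  shows "(\<Sum>ys\<in>permutations_of_set C. f (permute_list \<pi> ys)) =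
         (\<Sum>ys\<in>permutations_of_set C. f ys)"
proof (rule sum.reindex_bij_witness[where i = "permute_list (inv \<pi>)" and j = "permute_list \<pi>"])
  have inv: "inv \<pi> permutes {..<card C}"
    using assms(2) by (rule permutes_inv)
  fix ys assume ys: "ys \<in> permutations_of_set C"
  then have len: "length ys = card C"
    by (rule length_finite_permutations_of_set)
  show "permute_list (inv \<pi>) (permute_list \<pi> ys) = ys"
    using permute_list_compose[of "inv \<pi>" ys \<pi>] inv assms(2)
    by (simp add: len permutes_inv_o)
  show "permute_list \<pi> (permute_list (inv \<pi>) ys) = ys"
    using permute_list_compose[of \<pi> ys "inv \<pi>"] assms(2)
    by (simp add: len permutes_inv_o)
  show "permute_list \<pi> ys \<in> permutations_of_set C" "permute_list (inv \<pi>) ys \<in> permutations_of_set C"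
    using ys assms(2) inv len by (auto simp: permutations_of_set_def)
qed simp_all

text \<open>The complements in \<open>U\<close> also have equal size; a bijection from
  \<open>A\<close> to \<open>B\<close> and one between the complements are glued together.\<close>

lemma ex_permutes_image:
  assumes "finite U" "A \<subseteq> U" "B \<subseteq> U" "card A = card B"
  obtains \<pi> where "\<pi> permutes U" "\<pi> ` A = B"
proof -
  have fin: "finite A" "finite B"
    using assms finite_subset by auto
  obtain f where f: "bij_betw f A B"
    using finite_same_card_bij[OF fin assms(4)] by blast
  have "card (U - A) = card (U - B)"
    using assms fin by (simp add: card_Diff_subset)
  then obtain g where g: "bij_betw g (U - A) (U - B)"
    using finite_same_card_bij[of "U - A" "U - B"] assms(1) by auto
  define \<pi> where "\<pi> x = (if x \<in> A then f x else if x \<in> U then g x else x)" for x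
  have fA: "bij_betw \<pi> A B"
    using f bij_betw_cong[of A \<pi> f B] by (simp add: \<pi>_def)
  have gA: "bij_betw \<pi> (U - A) (U - B)"
    using g bij_betw_cong[of "U - A" \<pi> g "U - B"] by (simp add: \<pi>_def)
  have "bij_betw \<pi> (A \<union> (U - A)) (B \<union> (U - B))"
    using fA gA by (rule bij_betw_combine) auto
  moreover have "A \<union> (U - A) = U" "B \<union> (U - B) = U"
    using assms by auto
  ultimately have "\<pi> permutes U"
    using assms(2) by (intro bij_imp_permutes) (auto simp: \<pi>_def)
  then show thesis
    using that fA by (simp add: bij_betw_def)
qed

text \<open>A permutation carrying \<open>P\<close> to \<open>Q\<close> reduces this to
  exchangeability. It serves to replace a column by the row of arrivals.\<close>

lemma sum_image_positions:
  assumes "finite C" "P \<subseteq> {..<card C}" "Q \<subseteq> {..<card C}" "card P = card Q"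
  shows "(\<Sum>ys\<in>permutations_of_set C. f ((!) ys ` P)) =
         (\<Sum>ys\<in>permutations_of_set C. f ((!) ys ` Q))"
proof -
  obtain \<pi> where \<pi>: "\<pi> permutes {..<card C}" "\<pi> ` P = Q"
    using ex_permutes_image[OF finite_lessThan assms(2-4)] by metis
  have "f ((!) (permute_list \<pi> ys) ` P) = f ((!) ys ` Q)" if "ys \<in> permutations_of_set C" for ys
  proof -
    have "length ys = card C"
      using that by (rule length_finite_permutations_of_set)
    then have "(!) (permute_list \<pi> ys) ` P = (!) ys ` \<pi> ` P"
      unfolding image_image using assms(2) \<pi>(1)
      by (intro image_cong) (auto simp: permute_list_nth)
    then show ?thesis
      using \<pi>(2) by simp
  qed
  then show ?thesis
    using sum_permute_list[OF assms(1) \<pi>(1), of "\<lambda>ys. f ((!) ys ` P)"] by simp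
qed

text \<open>Swapping \<open>i\<close> with \<open>p\<close> inside the column preserves
  \<open>g\<close> and turns "the maximum is at \<open>p\<close>" into "the maximum is at
  \<open>i\<close>". Hence the \<open>n\<close> positions of the column carry equal weight, and
  exactly one of them holds the maximum. This expresses the independence of \<open>g\<close> and the
  win.\<close>

lemma sum_times_wins:
  fixes g :: "candidate list \<Rightarrow> real"
  assumes C: "finite C" "n * n \<le> card C" and i: "i < n"
    and g: "\<And>p ys. p \<in> grid_column n i \<Longrightarrow> ys \<in> permutations_of_set C \<Longrightarrow>
              g (permute_list (Transposition.transpose i p) ys) = g ys"
  shows "(\<Sum>ys\<in>permutations_of_set C. g ys * of_bool (wins n ys i)) =
         (\<Sum>ys\<in>permutations_of_set C. g ys) / n"
proof -
  let ?P = "permutations_of_set C" and ?K = "grid_column n i"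
  define top where "top ys p = (\<forall>q\<in>?K. ys ! q \<le> ys ! p)" for ys :: "candidate list" and p
  have pos: "0 < n"
    using i by simp
  have inC: "p < card C" if "p \<in> ?K" for p
    using grid_column_less[OF i that] C(2) by simp
  have move: "(\<Sum>ys\<in>?P. g ys * of_bool (top ys p)) = (\<Sum>ys\<in>?P. g ys * of_bool (wins n ys i))"
    if p: "p \<in> ?K" for p
  proof -
    let ?t = "Transposition.transpose i p"
    have t: "?t permutes {..<card C}"
      using inC grid_column_self[OF pos] p by (intro permutes_swap_id) auto
    have tK: "?t ` ?K = ?K"
      using p grid_column_self[OF pos, of i] by simp
    have "top (permute_list ?t ys) p = wins n ys i" if "ys \<in> ?P" for ys
    proof -
      have len: "length ys = card C"
        using that by (rule length_finite_permutations_of_set)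
      have "top (permute_list ?t ys) p \<longleftrightarrow> (\<forall>q\<in>?K. ys ! ?t q \<le> ys ! i)"
        using p inC t by (simp add: top_def permute_list_nth len)
      also have "\<dots> \<longleftrightarrow> (\<forall>q\<in>?t ` ?K. ys ! q \<le> ys ! i)"
        by blast
      finally show ?thesis
        by (simp add: tK wins_def)
    qed
    then have "(\<Sum>ys\<in>?P. g (permute_list ?t ys) * of_bool (top (permute_list ?t ys) p)) =
               (\<Sum>ys\<in>?P. g ys * of_bool (wins n ys i))"
      using g[OF p] by simp
    then show ?thesis
      using sum_permute_list[OF C(1) t, of "\<lambda>ys. g ys * of_bool (top ys p)"] by simp
  qed
  have one: "(\<Sum>p\<in>?K. of_bool (top ys p)) = (1 :: real)" if "ys \<in> ?P" for ys
  proof -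
    have len: "length ys = card C"
      using that by (rule length_finite_permutations_of_set)
    have dist: "distinct ys"
      using that by (simp add: permutations_of_set_def)
    have "Max ((!) ys ` ?K) \<in> (!) ys ` ?K"
      using grid_column_self[OF pos, of i] by (intro Max_in) auto
    then obtain p where p: "p \<in> ?K" "ys ! p = Max ((!) ys ` ?K)"
      by auto
    have top_p: "top ys p"
      using p by (simp add: top_def)
    \<comment> \<open>Antisymmetry of the tie-broken order makes the two candidates equal, and
      distinctness of \<open>ys\<close> then makes the positions equal.\<close>
    have unique: "q = p" if "q \<in> ?K" "top ys q" for q
    proof -
      have "ys ! q = ys ! p"
        using that top_p p(1) by (auto simp: top_def intro: antisym)
      then show ?thesis
        using dist that(1) p(1) inC by (simp add: nth_eq_iff_index_eq len)
    qed
    have "of_bool (top ys q) = (if q = p then 1 else 0 :: real)" if "q \<in> ?K" for q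
      using unique[OF that] top_p by (cases "q = p") auto
    then show ?thesis
      using p(1) by (simp add: sum.delta)
  qed
  \<comment> \<open>Double counting: \<open>n\<close> equal sums, whose indicators add up to one on
    each ordering.\<close>
  have "n * (\<Sum>ys\<in>?P. g ys * of_bool (wins n ys i)) =
        (\<Sum>p\<in>?K. \<Sum>ys\<in>?P. g ys * of_bool (top ys p))"
    using move by (simp add: card_grid_column[OF pos])
  also have "\<dots> = (\<Sum>ys\<in>?P. g ys * (\<Sum>p\<in>?K. of_bool (top ys p)))"
    by (subst sum.swap) (simp only: sum_distrib_left)
  also have "\<dots> = (\<Sum>ys\<in>?P. g ys)"
    using one by simp
  finally show ?thesis
    using pos by (simp add: field_simps)
qed

text \<open>Provides the invariance required by \<open>sum_times_wins\<close>: a swap inside column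
  \<open>i\<close> fixes all other columns pointwise and column \<open>i\<close> as a set.\<close>

lemma grid_column_permute_list:
  assumes "i < n" "k < n" "p \<in> grid_column n i" "n * n \<le> length ys"
  shows "k \<noteq> i \<Longrightarrow> wins n (permute_list (Transposition.transpose i p) ys) k = wins n ys k"
    and "(!) (permute_list (Transposition.transpose i p) ys) ` grid_column n k = (!) ys ` grid_column n k"
proof -
  let ?t = "Transposition.transpose i p"
  have pos: "0 < n"
    using assms by simp
  have inK: "q < length ys" if "q \<in> grid_column n k" for q
    using grid_column_less[OF assms(2) that] assms(4) by simp
  have t: "?t permutes {..<length ys}"
    using grid_column_less[OF assms(1) assms(3)] grid_column_less[OF assms(1) grid_column_self[OF pos]] assms(4)
    by (intro permutes_swap_id) auto
  \<comment> \<open>Residues modulo \<open>n\<close> tell columns apart, so \<open>q\<close> is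
    neither \<open>i\<close> nor \<open>p\<close>.\<close>
  have fix_k: "?t q = q" if "q \<in> grid_column n k" "k \<noteq> i" for q
    using that grid_column_mod[OF assms(1,3)] grid_column_mod[OF assms(2) that(1)] assms(1)
    by (auto simp: Transposition.transpose_def)
  show "wins n (permute_list ?t ys) k = wins n ys k" if "k \<noteq> i"
    using fix_k that inK t grid_column_self[OF pos, of k] by (simp add: wins_def permute_list_nth)
  have "?t ` grid_column n k = grid_column n k"
    using fix_k assms(3) grid_column_self[OF pos, of i] by (cases "k = i") auto
  moreover have "(!) (permute_list ?t ys) ` grid_column n k = (!) ys ` ?t ` grid_column n k"
    unfolding image_image using inK t by (intro image_cong) (auto simp: permute_list_nth)
  ultimately show "(!) (permute_list ?t ys) ` grid_column n k = (!) ys ` grid_column n k"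
    by simp
qed

text \<open>Induction on \<open>T\<close>: the win of column \<open>i\<close> contributes
  \<open>1 / n\<close>, and each column required to lose an independent factor
  \<open>1 - 1 / n\<close>.\<close>

lemma sum_win_value:
  assumes C: "finite C" "n * n \<le> card C" and i: "i < n" and T: "T \<subseteq> {..<n} - {i}"
  shows "(\<Sum>ys\<in>permutations_of_set C. win_value n ys i T) =
         (1 / n) * (1 - 1 / n) ^ card T *
         (\<Sum>ys\<in>permutations_of_set C. cvalue (Max (set (take n ys))))"
proof -
  let ?P = "permutations_of_set C"
  have len: "length ys = card C" if "ys \<in> ?P" for ys
    using that by (rule length_finite_permutations_of_set)
  have pos: "0 < n"
    using i by simp
  \<comment> \<open>On a win the arrival is the column maximum. Unlike
    \<open>cvalue (ys ! i)\<close>, the value \<open>m\<close> is invariant under swaps inside the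
    column.\<close>
  define m where "m ys = cvalue (Max ((!) ys ` grid_column n i))" for ys
  have val: "win_value n ys i S =
      m ys * of_bool (wins n ys i) * (\<Prod>j\<in>S. 1 - of_bool (wins n ys j))" for ys S
  proof -
    have "Max ((!) ys ` grid_column n i) = ys ! i" if "wins n ys i"
      using that grid_column_self[OF pos, of i] by (intro Max_eqI) (auto simp: wins_def)
    then show ?thesis
      by (simp add: win_value_def m_def)
  qed
  have "finite T"
    using T finite_subset by blast
  then show ?thesis
    using T
  proof (induction T rule: finite_induct)
    case empty
    have "(\<Sum>ys\<in>?P. win_value n ys i {}) = (\<Sum>ys\<in>?P. m ys) / n"
      unfolding val using sum_times_wins[OF C i, of m] grid_column_permute_list(2)[OF i i] C(2) len
      by (simp add: m_def)
    \<comment> \<open>A column and the row of arrivals both have \<open>n\<close> positions, so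
      their maxima have the same sum over all orderings.\<close>
    also have "(\<Sum>ys\<in>?P. m ys) = (\<Sum>ys\<in>?P. cvalue (Max ((!) ys ` {..<n})))"
      unfolding m_def
    proof (rule sum_image_positions[OF C(1)])
      show "grid_column n i \<subseteq> {..<card C}"
        using grid_column_less[OF i] C(2) by fastforce
      show "{..<n} \<subseteq> {..<card C}"
        using C(2) le_square[of n] by (intro lessThan_subset_iff[THEN iffD2]) linarith
    qed (simp add: card_grid_column[OF pos])
    also have "\<dots> = (\<Sum>ys\<in>?P. cvalue (Max (set (take n ys))))"
    proof (intro sum.cong refl)
      fix ys assume "ys \<in> ?P"
      then have "n \<le> length ys"
        using C(2) len le_trans[of n "n * n"] by simp
      then show "cvalue (Max ((!) ys ` {..<n})) = cvalue (Max (set (take n ys)))"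
        by (simp add: nth_image[symmetric] atLeast0LessThan)
    qed
    finally show ?case
      by simp
  next
    case (insert k S)
    have k: "k < n" "k \<noteq> i" and S: "S \<subseteq> {..<n} - {i}"
      using insert.prems by auto
    \<comment> \<open>Column \<open>k\<close> is neither \<open>i\<close> nor in \<open>S\<close>,
      so swaps inside it do not affect the quantity.\<close>
    have inv: "win_value n (permute_list (Transposition.transpose k p) ys) i S = win_value n ys i S"
      if "p \<in> grid_column n k" "ys \<in> ?P" for p ys
    proof -
      have nn: "n * n \<le> length ys"
        using len that C(2) by simp
      have "wins n (permute_list (Transposition.transpose k p) ys) j = wins n ys j" if "j \<in> S" for j
        using that insert.hyps S grid_column_permute_list(1)[OF k(1) _ \<open>p \<in> grid_column n k\<close> nn, of j] by auto
      moreover have "wins n (permute_list (Transposition.transpose k p) ys) i = wins n ys i"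
        using grid_column_permute_list(1)[OF k(1) i that(1) nn] k(2) by simp
      ultimately show ?thesis
        unfolding val m_def using grid_column_permute_list(2)[OF k(1) i that(1) nn] by simp
    qed
    have "win_value n ys i (insert k S) = win_value n ys i S - win_value n ys i S * of_bool (wins n ys k)"
      for ys
      using insert.hyps by (simp add: win_value_def)
    then have "(\<Sum>ys\<in>?P. win_value n ys i (insert k S)) =
               (\<Sum>ys\<in>?P. win_value n ys i S) - (\<Sum>ys\<in>?P. win_value n ys i S) / n"
      using sum_times_wins[OF C k(1) inv] by (simp add: sum_subtractf)
    also have "\<dots> = (1 - 1 / n) * (\<Sum>ys\<in>?P. win_value n ys i S)"
      by (simp add: algebra_simps)
    finally show ?case
      using insert.IH[OF S] insert.hyps by simp
  qed
qed

subsection \<open>Payoff of the record policy\<close>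

text \<open>At most one summand survives, that of the first accepted arrival. Leaving
  \<open>seen\<close> arbitrary lets the induction move arrivals into the prefix.\<close>

lemma run_policy_payoff:
  "(case run_policy d seen xs of None \<Rightarrow> 0 | Some x \<Rightarrow> cvalue x) =
   (\<Sum>i<length xs. cvalue (xs ! i) * of_bool (d (seen @ take (Suc i) xs)) *
      (\<Prod>j<i. 1 - of_bool (d (seen @ take (Suc j) xs))))"
proof (induction xs arbitrary: seen)
  case (Cons x xs)
  show ?case
  proof (cases "d (seen @ [x])")
    case True
    then show ?thesis
      by (simp add: sum.lessThan_Suc_shift prod.lessThan_Suc_shift del: sum.lessThan_Suc prod.lessThan_Suc)
  next
    case False
    then show ?thesis
      using Cons.IH[of "seen @ [x]"]
      by (simp add: sum.lessThan_Suc_shift prod.lessThan_Suc_shift del: sum.lessThan_Suc prod.lessThan_Suc)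
  qed
qed simp

lemma payoff_record_policy:
  assumes "length xs = n"
  shows "payoff (record_policy n L) xs = (\<Sum>i<n. win_value n (xs @ L) i {..<i})"
proof -
  have "record_policy n L (take (Suc i) xs) = wins n (xs @ L) i" if "i < n" for i
    using that assms by (simp add: record_policy_def wins_append_iff take_Suc_conv_app_nth)
  then show ?thesis
    unfolding payoff_def run_policy_payoff win_value_def
    using assms by (auto intro!: sum.cong prod.cong simp: nth_append)
qed

text \<open>The value of the winning arrival if exactly one column wins, and \<open>0\<close>
  otherwise. In contrast to the payoff, it does not depend on which columns are inspected
  first.\<close>

definition sole_win_value :: "nat \<Rightarrow> candidate list \<Rightarrow> real" where
  "sole_win_value n ys = (\<Sum>i<n. win_value n ys i ({..<n} - {i}))"

text \<open>The payoff only asks the columns before \<open>i\<close> to lose. Dropping the later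
  factors, all at most \<open>1\<close>, can only increase each summand because values are
  nonnegative.\<close>

lemma payoff_ge_sole_win_value:
  assumes "length xs = n" "\<And>x. x \<in> set xs \<Longrightarrow> 0 \<le> cvalue x"
  shows "sole_win_value n (xs @ L) \<le> payoff (record_policy n L) xs"
  unfolding payoff_record_policy[OF assms(1)] sole_win_value_def win_value_def
proof (intro sum_mono mult_left_mono)
  fix i assume "i \<in> {..<n}"
  then have i: "i < n"
    by simp
  then have split: "{..<n} - {i} = {..<i} \<union> {i<..<n}"
    by auto
  have "(\<Prod>j\<in>{..<n} - {i}. 1 - of_bool (wins n (xs @ L) j) :: real) =
    (\<Prod>j<i. 1 - of_bool (wins n (xs @ L) j)) * (\<Prod>j\<in>{i<..<n}. 1 - of_bool (wins n (xs @ L) j))"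
    unfolding split by (rule prod.union_disjoint) auto
  also have "\<dots> \<le> (\<Prod>j<i. 1 - of_bool (wins n (xs @ L) j)) * 1"
    by (intro mult_left_mono prod_le_1 prod_nonneg) auto
  finally show "(\<Prod>j\<in>{..<n} - {i}. 1 - of_bool (wins n (xs @ L) j)) \<le>
                (\<Prod>j<i. 1 - of_bool (wins n (xs @ L) j) :: real)"
    by simp
  show "0 \<le> cvalue ((xs @ L) ! i) * of_bool (wins n (xs @ L) i)"
    using assms i by (simp add: nth_append)
qed

subsection \<open>Insensitivity to the adversarial order\<close>

text \<open>Permuting the history along with the arrivals moves whole columns, which a sum over all
  columns does not notice. As \<open>L\<close> runs over all orders of \<open>H\<close>, its own
  permutation may be inserted freely.\<close>

lemma sum_sole_win_value_permute:
  assumes H: "finite H" "n * (n - 1) \<le> card H" and xs: "length xs = n" and \<pi>: "\<pi> permutes {..<n}"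
  shows "(\<Sum>L\<in>permutations_of_set H. sole_win_value n (permute_list \<pi> xs @ L)) =
         (\<Sum>L\<in>permutations_of_set H. sole_win_value n (xs @ L))"
proof -
  \<comment> \<open>Entry \<open>q\<close> of \<open>L\<close> lies in column
    \<open>q mod n\<close>. It stays in its row and moves as \<pi> prescribes; entries beyond the
    grid are fixed.\<close>
  define \<rho> where "\<rho> q = (if q < n * (n - 1) then \<pi> (q mod n) + n * (q div n) else q)" for q
  have \<pi>_less: "\<pi> i < n" if "i < n" for i
    using permutes_in_image[OF \<pi>, of i] that by simp
  have in_range: "i + n * j < n * (n - 1)" if "i < n" "j < n - 1" for i j
  proof -
    have "i + n * j < n * Suc j"
      using that by simp
    also have "\<dots> \<le> n * (n - 1)"
      using that by (intro mult_le_mono2) simp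
    finally show ?thesis .
  qed
  have \<rho>_eq: "\<rho> (i + n * j) = \<pi> i + n * j" if "i < n" "j < n - 1" for i j
    using that in_range[OF that] by (simp add: \<rho>_def)
  have split: "\<exists>i j. q = i + n * j \<and> i < n \<and> j < n - 1" if "q < n * (n - 1)" for q
  proof (intro exI conjI)
    show "q = q mod n + n * (q div n)"
      by simp
    show "q mod n < n"
      using that by (cases n) auto
    show "q div n < n - 1"
      using that by (simp add: less_mult_imp_div_less mult.commute)
  qed
  have \<rho>: "\<rho> permutes {..<card H}"
  proof (rule permutes_subset)
    have "inj_on \<rho> {..<n * (n - 1)}"
    proof (rule inj_onI)
      fix p q assume "p \<in> {..<n * (n - 1)}" "q \<in> {..<n * (n - 1)}" and eq: "\<rho> p = \<rho> q"
      then obtain i j k l where p: "p = i + n * j" "i < n" "j < n - 1"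
        and q: "q = k + n * l" "k < n" "l < n - 1"
        using split by (metis lessThan_iff)
      have e: "\<pi> i + n * j = \<pi> k + n * l"
        using eq p q by (simp add: \<rho>_eq)
      have "(\<pi> i + n * j) mod n = \<pi> i" "(\<pi> k + n * l) mod n = \<pi> k"
        using \<pi>_less p q by simp_all
      then have "\<pi> i = \<pi> k"
        using e by simp
      moreover have "n * j = n * l"
        using e calculation by simp
      ultimately show "p = q"
        using p q permutes_inj[OF \<pi>] by (auto simp: inj_def)
    qed
    moreover have "\<rho> ` {..<n * (n - 1)} \<subseteq> {..<n * (n - 1)}"
      using split \<rho>_eq in_range \<pi>_less by (smt (verit) image_subset_iff lessThan_iff)
    ultimately have "bij_betw \<rho> {..<n * (n - 1)} {..<n * (n - 1)}"
      by (simp add: bij_betw_def endo_inj_surj)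
    then show "\<rho> permutes {..<n * (n - 1)}"
      by (rule bij_imp_permutes) (simp add: \<rho>_def)
    show "{..<n * (n - 1)} \<subseteq> {..<card H}"
      using H(2) by auto
  qed
  have "sole_win_value n (permute_list \<pi> xs @ permute_list \<rho> L) = sole_win_value n (xs @ L)"
    if L: "L \<in> permutations_of_set H" for L
  proof -
    have len: "length L = card H"
      using L by (rule length_finite_permutations_of_set)
    define ys where "ys = permute_list \<pi> xs @ permute_list \<rho> L"
    \<comment> \<open>Column \<open>i\<close> of the permuted grid is column \<open>\<pi> i\<close>
      of the original one.\<close>
    have wins: "wins n ys i = wins n (xs @ L) (\<pi> i)" if i: "i < n" for i
    proof -
      have "permute_list \<rho> L ! (i + n * j) = L ! (\<pi> i + n * j)" if "j < n - 1" for j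
        using in_range[OF i that] H(2) \<rho> \<rho>_eq[OF i that] by (simp add: permute_list_nth len)
      moreover have "permute_list \<pi> xs ! i = xs ! \<pi> i"
        using i xs \<pi> by (simp add: permute_list_nth)
      ultimately show ?thesis
        unfolding ys_def using i xs \<pi>_less by (simp add: wins_append_iff)
    qed
    have "win_value n ys i ({..<n} - {i}) = win_value n (xs @ L) (\<pi> i) ({..<n} - {\<pi> i})"
      if i: "i < n" for i
    proof -
      have "bij_betw \<pi> ({..<n} - {i}) ({..<n} - {\<pi> i})"
        using permutes_imp_bij[OF \<pi>] i by (simp add: bij_betw_def inj_on_diff inj_on_image_set_diff[where C="{..<n}"])
      then have "(\<Prod>j\<in>{..<n} - {\<pi> i}. 1 - of_bool (wins n (xs @ L) j) :: real) =
                 (\<Prod>j\<in>{..<n} - {i}. 1 - of_bool (wins n (xs @ L) (\<pi> j)))"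
        by (rule prod.reindex_bij_betw[symmetric])
      also have "\<dots> = (\<Prod>j\<in>{..<n} - {i}. 1 - of_bool (wins n ys j))"
        using wins by simp
      moreover have "ys ! i = (xs @ L) ! \<pi> i"
        using i xs \<pi> \<pi>_less by (simp add: ys_def nth_append permute_list_nth)
      ultimately show ?thesis
        using wins[OF i] by (simp add: win_value_def)
    qed
    then have "sole_win_value n ys = (\<Sum>i<n. win_value n (xs @ L) (\<pi> i) ({..<n} - {\<pi> i}))"
      by (simp add: sole_win_value_def)
    also have "\<dots> = sole_win_value n (xs @ L)"
      unfolding sole_win_value_def using permutes_imp_bij[OF \<pi>]
      by (rule sum.reindex_bij_betw)
    finally show ?thesis
      by (simp add: ys_def)
  qed
  then show ?thesis
    using sum_permute_list[OF H(1) \<rho>, of "\<lambda>L. sole_win_value n (permute_list \<pi> xs @ L)"] by simp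
qed

text \<open>Two orders of the same arrivals differ by a permutation of positions. Thus an order
  chosen from \<open>H\<close> alone, before \<open>L\<close> is drawn, may be exchanged for any
  other.\<close>

lemma sum_sole_win_value_order:
  assumes "finite H" "n * (n - 1) \<le> card H" "finite U" "card U = n"
    and "xs \<in> permutations_of_set U" "zs \<in> permutations_of_set U"
  shows "(\<Sum>L\<in>permutations_of_set H. sole_win_value n (xs @ L)) =
         (\<Sum>L\<in>permutations_of_set H. sole_win_value n (zs @ L))"
proof -
  have "mset xs = mset zs"
    using assms(5,6) by (simp add: permutations_of_set_def set_eq_iff_mset_eq_distinct[symmetric])
  then obtain \<pi> where \<pi>: "\<pi> permutes {..<length zs}" "permute_list \<pi> zs = xs"
    by (rule mset_eq_permutation)
  moreover have "length zs = n"
    using assms(4,6) length_finite_permutations_of_set by blast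
  ultimately show ?thesis
    using sum_sole_win_value_permute[OF assms(1,2), of zs \<pi>] by simp
qed

subsection \<open>Expectations as sums over all orders\<close>

lemma finite_history_sets: "finite C \<Longrightarrow> finite (history_sets h C)"
  by (rule finite_subset[of _ "Pow C"]) (auto simp: history_sets_def)

lemma history_sets_nonempty:
  assumes "finite C" "h \<le> card C"
  shows "history_sets h C \<noteq> {}"
  using obtain_subset_with_card_n[OF assms(2)] by (auto simp: history_sets_def)

text \<open>Cutting an ordering of \<open>C\<close> after \<open>n\<close> entries is a bijection:
  the tail determines both \<open>H\<close> and \<open>L\<close>. So a random history with random
  orders of both parts amounts to one uniform ordering.\<close>

lemma sum_history_sets_orders:
  fixes f :: "candidate list \<Rightarrow> real"
  assumes "C \<in> instances n h"
  shows "(\<Sum>H\<in>history_sets h C. \<Sum>xs\<in>permutations_of_set (C - H). \<Sum>L\<in>permutations_of_set H. f (xs @ L))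
         = (\<Sum>ys\<in>permutations_of_set C. f ys)"
proof -
  have C: "finite C" "card C = n + h"
    using assms by (auto simp: instances_def)
  let ?S = "SIGMA H:history_sets h C. permutations_of_set (C - H) \<times> permutations_of_set H"
  have fin: "finite H" if "H \<in> history_sets h C" for H
    using that C(1) finite_subset by (auto simp: history_sets_def)
  have len: "length xs = n" if "xs \<in> permutations_of_set (C - H)" "H \<in> history_sets h C" for xs H
    using that length_finite_permutations_of_set[OF that(1)] C fin[OF that(2)]
    by (auto simp: history_sets_def card_Diff_subset)
  have "(\<Sum>H\<in>history_sets h C. \<Sum>xs\<in>permutations_of_set (C - H). \<Sum>L\<in>permutations_of_set H. f (xs @ L))
      = (\<Sum>(H, xs, L)\<in>?S. f (xs @ L))"
    using C(1) fin finite_history_sets[OF C(1)]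
    by (subst sum.Sigma[symmetric]) (auto simp: sum.cartesian_product)
  also have "\<dots> = (\<Sum>ys\<in>permutations_of_set C. f ys)"
  proof (rule sum.reindex_bij_witness[where
        i = "\<lambda>ys. (set (drop n ys), take n ys, drop n ys)" and j = "\<lambda>(H, xs, L). xs @ L"])
    fix a assume "a \<in> ?S"
    then obtain H xs L where a: "a = (H, xs, L)" "H \<in> history_sets h C"
        "xs \<in> permutations_of_set (C - H)" "L \<in> permutations_of_set H"
      by blast
    show "(\<lambda>ys. (set (drop n ys), take n ys, drop n ys)) ((\<lambda>(H, xs, L). xs @ L) a) = a"
      using a len[OF a(3,2)] by (simp add: permutations_of_set_def)
    show "(\<lambda>(H, xs, L). xs @ L) a \<in> permutations_of_set C"
      using a by (auto simp: permutations_of_set_def history_sets_def)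
    show "f ((\<lambda>(H, xs, L). xs @ L) a) = (case a of (H, xs, L) \<Rightarrow> f (xs @ L))"
      by (simp add: a)
  next
    fix ys assume ys: "ys \<in> permutations_of_set C"
    have set: "set ys = C" "distinct ys"
      using ys by (auto simp: permutations_of_set_def)
    have len: "length ys = n + h"
      using ys C(2) length_finite_permutations_of_set by metis
    have dis: "set (take n ys) \<inter> set (drop n ys) = {}"
      using set_take_disj_set_drop_if_distinct[OF set(2), of n n] by simp
    have "set (take n ys) \<union> set (drop n ys) = C"
      by (metis append_take_drop_id set(1) set_append)
    then show "(set (drop n ys), take n ys, drop n ys) \<in> ?S"
      using dis set len distinct_card[of "drop n ys"]
      by (auto simp: permutations_of_set_def history_sets_def)
    show "(\<lambda>(H, xs, L). xs @ L) (set (drop n ys), take n ys, drop n ys) = ys"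
      by simp
  qed
  finally show ?thesis .
qed

lemma card_instances:
  assumes "C \<in> instances n h" "H \<in> history_sets h C"
  shows "finite C" "finite H" "card H = h" "card (C - H) = n"
        "card (permutations_of_set H) = fact h" "card (permutations_of_set (C - H)) = fact n"
proof -
  show *: "finite C" "finite H" "card H = h" "card (C - H) = n"
    using assms finite_subset[of H C] by (auto simp: instances_def history_sets_def card_Diff_subset)
  show "card (permutations_of_set H) = fact h" "card (permutations_of_set (C - H)) = fact n"
    using * by simp_all
qed

text \<open>\<open>S H\<close> covers both models: all orders of the online set, or the singleton of
  the adversary's order.\<close>

lemma expected_ALG_record:
  assumes C: "C \<in> instances n h"
    and S: "\<And>H. H \<in> history_sets h C \<Longrightarrow> finite (S H) \<and> S H \<noteq> {}"
  shows "expected_ALG h C (\<lambda>H. pmf_of_set (S H)) (record_algorithm n) =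
    (\<Sum>H\<in>history_sets h C. (\<Sum>xs\<in>S H.
       (\<Sum>L\<in>permutations_of_set H. payoff (record_policy n L) xs) / fact h) / card (S H)) /
    card (history_sets h C)"
proof -
  have fin: "finite C" "h \<le> card C"
    using C by (auto simp: instances_def)
  have 1: "measure_pmf.expectation
          (record_algorithm n H \<bind> (\<lambda>d. return_pmf (payoff d xs))) (\<lambda>v. v) =
        (\<Sum>L\<in>permutations_of_set H. payoff (record_policy n L) xs) / fact h"
    and 2: "finite (set_pmf (record_algorithm n H))"
    if "H \<in> history_sets h C" for H xs
    using card_instances[OF C that]
    by (simp_all add: record_algorithm_def bind_assoc_pmf bind_return_pmf
        pmf_expectation_bind_pmf_of_set sum_distrib_left divide_inverse mult.commute)
  have 3: "measure_pmf.expectation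
          (pmf_of_set (S H) \<bind> (\<lambda>xs. record_algorithm n H \<bind> (\<lambda>d. return_pmf (payoff d xs)))) (\<lambda>v. v) =
        (\<Sum>xs\<in>S H. (\<Sum>L\<in>permutations_of_set H. payoff (record_policy n L) xs) / fact h) / card (S H)"
    if "H \<in> history_sets h C" for H
    using S[OF that] 1[OF that] 2[OF that]
    by (subst pmf_expectation_bind_pmf_of_set) (auto simp: sum_distrib_left divide_inverse mult.commute)
  show ?thesis
    unfolding expected_ALG_def ALG_pmf_def
    using finite_history_sets[OF fin(1)] history_sets_nonempty[OF fin] S 2 3
    by (subst pmf_expectation_bind_pmf_of_set)
       (auto simp: sum_distrib_left divide_inverse mult.commute)
qed

text \<open>The first \<open>n\<close> entries form the online set, and each \<open>H\<close> arises
  from \<open>fact n * fact h\<close> orderings.\<close>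

lemma expected_OPT_eq:
  assumes C: "C \<in> instances n h"
  shows "expected_OPT h C =
    (\<Sum>ys\<in>permutations_of_set C. cvalue (Max (set (take n ys)))) /
    (fact n * fact h * card (history_sets h C))"
proof -
  have fin: "finite C" "h \<le> card C"
    using C by (auto simp: instances_def)
  have "(\<Sum>xs\<in>permutations_of_set (C - H). \<Sum>L\<in>permutations_of_set H. cvalue (Max (set (take n (xs @ L)))))
      = fact n * fact h * cvalue (Max (C - H))" if "H \<in> history_sets h C" for H
  proof -
    have "set (take n (xs @ L)) = C - H" if "xs \<in> permutations_of_set (C - H)" for xs L
      using that length_finite_permutations_of_set[OF that] card_instances[OF C \<open>H \<in> _\<close>]
      by (simp add: permutations_of_set_def)
    then show ?thesis
      using card_instances[OF C that] by simp
  qed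
  then have "(\<Sum>ys\<in>permutations_of_set C. cvalue (Max (set (take n ys)))) =
        fact n * fact h * (\<Sum>H\<in>history_sets h C. cvalue (Max (C - H)))"
    using sum_history_sets_orders[OF C, of "\<lambda>ys. cvalue (Max (set (take n ys)))"]
    by (simp add: sum_distrib_left)
  then show ?thesis
    unfolding expected_OPT_def
    using finite_history_sets[OF fin(1)] history_sets_nonempty[OF fin]
    by (simp add: integral_pmf_of_set)
qed

lemma expected_OPT_nonneg:
  assumes "C \<in> instances n h" "0 < n"
  shows "0 \<le> expected_OPT h C"
  unfolding expected_OPT_eq[OF assms(1)]
proof (intro divide_nonneg_nonneg sum_nonneg)
  fix ys assume ys: "ys \<in> permutations_of_set C"
  then have "length ys = n + h"
    using assms length_finite_permutations_of_set[OF ys] by (simp add: instances_def)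
  then have "Max (set (take n ys)) \<in> set (take n ys)"
    using assms(2) by (intro Max_in) auto
  then have "Max (set (take n ys)) \<in> C"
    using ys in_set_takeD by (fastforce simp: permutations_of_set_def)
  then show "0 \<le> cvalue (Max (set (take n ys)))"
    using assms(1) by (simp add: instances_def)
qed simp

section \<open>Exponential bounds on powers of \<open>1 - 1 / n\<close>\<close>

lemma one_minus_inverse_power_le: 
  assumes "0 < n"
  shows "(1 - 1 / real n) ^ n \<le> 1 / exp 1"
proof -
  have "(1 - 1 / real n) ^ n \<le> exp (- (1 / n)) ^ n"
    using assms exp_ge_add_one_self[of "- (1 / real n)"] by (intro power_mono) auto
  also have "\<dots> = 1 / exp 1"
    using assms by (simp add: exp_of_nat_mult[symmetric] exp_minus field_simps)
  finally show ?thesis .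
qed

lemma one_minus_inverse_power_ge:
  assumes "0 < n"
  shows "1 / exp 1 \<le> (1 - 1 / real n) ^ (n - 1)"
proof (cases "n = 1")
  case False
  then obtain m where n: "n = Suc m" and m: "0 < m"
    using assms by (cases n) auto
  \<comment> \<open>With \<open>n = m + 1\<close>, the number \<open>1 - 1 / n\<close> is the
    reciprocal of \<open>1 + 1 / m\<close>, so an upper bound on the power of the latter
    suffices.\<close>
  have "(1 + 1 / real m) ^ m \<le> exp (1 / m) ^ m"
    using exp_ge_add_one_self[of "1 / real m"] by (intro power_mono) auto
  also have "\<dots> = exp 1"
    using m by (simp add: exp_of_nat_mult[symmetric])
  finally have "1 / exp 1 \<le> 1 / (1 + 1 / real m) ^ m"
    by (intro divide_left_mono mult_pos_pos zero_less_power) (auto simp: add_pos_nonneg)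
  also have "\<dots> = (1 - 1 / real n) ^ (n - 1)"
    using m by (simp add: n power_one_over[symmetric] field_simps)
  finally show ?thesis .
qed simp

subsection \<open>Competitiveness\<close>

lemma record_algorithm_RO:
  assumes n: "0 < n" and h: "n * (n - 1) \<le> h"
  shows "RO_competitive n h (1 - 1 / exp 1) (record_algorithm n)"
  unfolding RO_competitive_def
proof
  fix C assume C: "C \<in> instances n h"
  have fin: "finite C" "card C = n + h"
    using C by (auto simp: instances_def)
  \<comment> \<open>The bound on \<open>h\<close> is what makes the grid fit:
    \<open>n + n * (n - 1) = n * n\<close>.\<close>
  have nn: "n * n \<le> card C"
    using n h fin(2) by (cases n) auto
  have "expected_ALG h C (\<lambda>H. pmf_of_set (permutations_of_set (C - H))) (record_algorithm n) =
     (\<Sum>H\<in>history_sets h C. (\<Sum>xs\<in>permutations_of_set (C - H).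
       (\<Sum>L\<in>permutations_of_set H. payoff (record_policy n L) xs) / fact h) / 
        card (permutations_of_set (C - H))) / card (history_sets h C)"
    using fin(1) by (intro expected_ALG_record[OF C]) auto
  also have "\<dots> = (\<Sum>H\<in>history_sets h C. \<Sum>xs\<in>permutations_of_set (C - H).
       \<Sum>L\<in>permutations_of_set H. payoff (record_policy n L) xs) /
       (fact n * fact h * card (history_sets h C))"
    using card_instances(6)[OF C] by (simp add: sum_divide_distrib[symmetric] del: card_permutations_of_set)
  also have "(\<Sum>H\<in>history_sets h C. \<Sum>xs\<in>permutations_of_set (C - H).
       \<Sum>L\<in>permutations_of_set H. payoff (record_policy n L) xs) =
       (\<Sum>H\<in>history_sets h C. \<Sum>xs\<in>permutations_of_set (C - H).
         \<Sum>L\<in>permutations_of_set H. \<Sum>i<n. win_value n (xs @ L) i {..<i})"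
    using card_instances(4)[OF C] length_finite_permutations_of_set
    by (intro sum.cong refl payoff_record_policy) fastforce
  also have "\<dots> = (\<Sum>ys\<in>permutations_of_set C. \<Sum>i<n. win_value n ys i {..<i})"
    by (rule sum_history_sets_orders[OF C])
  also have "\<dots> = (\<Sum>i<n. \<Sum>ys\<in>permutations_of_set C. win_value n ys i {..<i})"
    by (rule sum.swap)
  also have "\<dots> = (\<Sum>i<n. (1 / n) * (1 - 1 / n) ^ i *
       (\<Sum>ys\<in>permutations_of_set C. cvalue (Max (set (take n ys)))))"
    by (intro sum.cong refl) (subst sum_win_value[OF fin(1) nn], auto)
  also have "\<dots> = (1 / n) * (\<Sum>i<n. (1 - 1 / n) ^ i) *
       (\<Sum>ys\<in>permutations_of_set C. cvalue (Max (set (take n ys))))"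
    by (simp only: sum_distrib_left[symmetric] sum_distrib_right[symmetric])
  \<comment> \<open>Geometric sum with ratio \<open>1 - 1 / n\<close>; the prefactor
    \<open>1 / n\<close> is one minus the ratio.\<close>
  also have "(1 / n) * (\<Sum>i<n. (1 - 1 / real n) ^ i) = 1 - (1 - 1 / n) ^ n"
    using one_diff_power_eq[of "1 - 1 / real n" n] by simp
  finally have "expected_ALG h C (\<lambda>H. pmf_of_set (permutations_of_set (C - H))) (record_algorithm n) =
      (1 - (1 - 1 / n) ^ n) * expected_OPT h C"
    by (simp add: expected_OPT_eq[OF C])
  then show "(1 - 1 / exp 1) * expected_OPT h C \<le>
      expected_ALG h C (\<lambda>H. pmf_of_set (permutations_of_set (C - H))) (record_algorithm n)"
    using one_minus_inverse_power_le[OF n] expected_OPT_nonneg[OF C n]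
    by (simp add: mult_right_mono)
qed

text \<open>The total of sole wins is computed over all orderings of \<open>C\<close>, transferred
  to the adversary's orders by order insensitivity, and only then bounded by the payoff.\<close>

lemma record_algorithm_AO:
  assumes n: "0 < n" and h: "n * (n - 1) \<le> h"
  shows "AO_competitive n h (1 / exp 1) (record_algorithm n)"
  unfolding AO_competitive_def
proof (intro ballI)
  fix C \<sigma> assume C: "C \<in> instances n h" and \<sigma>: "\<sigma> \<in> adversarial_orders h C"
  have fin: "finite C" "card C = n + h"
    using C by (auto simp: instances_def)
  have nn: "n * n \<le> card C"
    using n h fin(2) by (cases n) auto
  have \<sigma>_in: "\<sigma> H \<in> permutations_of_set (C - H)" if "H \<in> history_sets h C" for H
    using \<sigma> that by (simp add: adversarial_orders_def)
  have "(\<Sum>ys\<in>permutations_of_set C. sole_win_value n ys) =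
      (\<Sum>i<n. \<Sum>ys\<in>permutations_of_set C. win_value n ys i ({..<n} - {i}))"
    unfolding sole_win_value_def by (rule sum.swap)
  also have "\<dots> = (\<Sum>i<n. (1 / n) * (1 - 1 / n) ^ (n - 1) *
       (\<Sum>ys\<in>permutations_of_set C. cvalue (Max (set (take n ys)))))"
    by (intro sum.cong refl) (subst sum_win_value[OF fin(1) nn], auto)
  also have "\<dots> = (1 - 1 / n) ^ (n - 1) *
       (\<Sum>ys\<in>permutations_of_set C. cvalue (Max (set (take n ys))))"
    using n by simp
  finally have sole: "(\<Sum>ys\<in>permutations_of_set C. sole_win_value n ys) =
      (1 - 1 / n) ^ (n - 1) * (\<Sum>ys\<in>permutations_of_set C. cvalue (Max (set (take n ys))))" .
  have "(\<Sum>ys\<in>permutations_of_set C. sole_win_value n ys) =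
      (\<Sum>H\<in>history_sets h C. \<Sum>xs\<in>permutations_of_set (C - H).
         \<Sum>L\<in>permutations_of_set H. sole_win_value n (xs @ L))"
    by (rule sum_history_sets_orders[OF C, symmetric])
  also have "\<dots> = (\<Sum>H\<in>history_sets h C. \<Sum>xs\<in>permutations_of_set (C - H).
         \<Sum>L\<in>permutations_of_set H. sole_win_value n (\<sigma> H @ L))"
    using card_instances[OF C] \<sigma>_in h fin(1)
    by (intro sum.cong[OF refl] sum_sole_win_value_order[where U = "C - _"]) auto
  \<comment> \<open>The summand no longer depends on \<open>xs\<close>, which ranges over
    \<open>fact n\<close> orders.\<close>
  also have "\<dots> = fact n * (\<Sum>H\<in>history_sets h C.
         \<Sum>L\<in>permutations_of_set H. sole_win_value n (\<sigma> H @ L))"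
    using card_instances(6)[OF C] by (simp add: sum_distrib_left del: card_permutations_of_set)
  also have "\<dots> \<le> fact n * (\<Sum>H\<in>history_sets h C.
         \<Sum>L\<in>permutations_of_set H. payoff (record_policy n L) (\<sigma> H))"
  proof (intro mult_left_mono sum_mono payoff_ge_sole_win_value)
    fix H assume H: "H \<in> history_sets h C"
    show "length (\<sigma> H) = n"
      using length_finite_permutations_of_set[OF \<sigma>_in[OF H]] card_instances[OF C H] by simp
    show "0 \<le> cvalue x" if "x \<in> set (\<sigma> H)" for x
      using that \<sigma>_in[OF H] C by (auto simp: permutations_of_set_def instances_def)
  qed simp
  also have "\<dots> = fact n * fact h * card (history_sets h C) *
      expected_ALG h C (\<lambda>H. return_pmf (\<sigma> H)) (record_algorithm n)"
    using expected_ALG_record[OF C, of "\<lambda>H. {\<sigma> H}"] finite_history_sets[OF fin(1)]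
      history_sets_nonempty[OF fin(1), of h] fin(2)
    by (simp add: pmf_of_set_singleton sum_divide_distrib[symmetric])
  finally have "(1 - 1 / n) ^ (n - 1) * expected_OPT h C \<le>
      expected_ALG h C (\<lambda>H. return_pmf (\<sigma> H)) (record_algorithm n)"
    unfolding expected_OPT_eq[OF C] sole
    using finite_history_sets[OF fin(1)] history_sets_nonempty[OF fin(1), of h] fin(2)
    by (simp add: card_gt_0_iff field_simps)
  moreover have "1 / exp 1 * expected_OPT h C \<le> (1 - 1 / n) ^ (n - 1) * expected_OPT h C"
    using one_minus_inverse_power_ge[OF n] expected_OPT_nonneg[OF C n] by (rule mult_right_mono)
  ultimately show "1 / exp 1 * expected_OPT h C \<le>
      expected_ALG h C (\<lambda>H. return_pmf (\<sigma> H)) (record_algorithm n)"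
    by simp
qed

theorem theorem10:
  fixes n h :: nat
  assumes "n \<ge> 1" and "h \<ge> n * (n - 1)"
  shows "\<exists>A :: algorithm. AO_competitive n h (1 / exp 1) A \<and> RO_competitive n h (1 - 1 / exp 1) A"
  using record_algorithm_AO[of n h] record_algorithm_RO[of n h] assms by (intro exI conjI) auto

end
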